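(* Let $(F_i)_{i\ge 1}$ be the Fibonacci sequence and let $S:=\sum_{i=1}^{\infty}\frac{1}{F_i}$. A real number $x$ has a Fibonacci expansion, i.e. there exists a sequence $(c_i)_{i\ge1}\in\{0,1\}^{\mathbb N}$ with $$x=\sum_{i=1}^{\infty}\frac{c_i}{F_i},$$ if and only if $x\in[0,S]$.
   Context: The Fibonacci sequence is defined by $F_1:=1$, $F_2:=1$ and $F_{i+2}:=F_{i+1}+F_i$ for $i=1,2,\ldots$. The series $\sum_{i=1}^\infty 1/F_i$ converges (its sum is approximately $3.360$). *)

theory Defs
  imports "HOL-Analysis.Analysis" "HOL-Number_Theory.Fib"
begin

text \<open>
  The library function \<^const>\<open>fib\<close> satisfies \<open>fib 1 = fib 2 = 1\<close>; its extra value \<open>fib 0 = 0\<close>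
  is never used.  Series over \<open>i \<ge> 1\<close> are shifted so that they are indexed from 0, with
  \<open>Suc i\<close> in place of \<open>i\<close>; \<open>c 0\<close> is irrelevant.
\<close>

definition fib_recip_sum :: real where
  "fib_recip_sum = (\<Sum>i. 1 / real (fib (Suc i)))"

definition has_fib_expansion :: "real \<Rightarrow> bool" where
  "has_fib_expansion x \<longleftrightarrow>
     (\<exists>c :: nat \<Rightarrow> nat. (\<forall>i\<ge>1. c i \<in> {0, 1}) \<and>
        (\<lambda>i. real (c (Suc i)) / real (fib (Suc i))) sums x)"

end

theory Submission
  imports Defs
begin

text \<open>
  The sums \<open>\<Sum>i. c i * a i\<close> with digits \<open>c i \<in> {0, 1}\<close> of a nonnegative convergent series fill the
  whole interval from 0 to \<open>\<Sum>i. a i\<close> as soon as no term exceeds the sum of the terms after it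
  (Kakeya's criterion). The digits come from the greedy algorithm: a term is taken whenever the
  partial sum stays at most \<open>x\<close>. The error is then always between 0 and the tail that is still
  available: after taking a term, error and tail have both dropped by that term; after skipping
  one, the error is below the skipped term, which is at most the next tail by hypothesis. Since
  the tails tend to 0, so does the error.

  For reciprocals of Fibonacci numbers the criterion is a telescoping argument. As
  \<open>fib (n + 2) \<le> 2 * fib (n + 1)\<close>, every term \<open>a i\<close> is at most twice its successor, that is,
  \<open>a i - a (i + 1) \<le> a (i + 1)\<close>; summing over \<open>i \<ge> n\<close> gives \<open>a n \<le> \<Sum>i>n. a i\<close>.
\<close>

fun greedy_sum :: "(nat \<Rightarrow> real) \<Rightarrow> real \<Rightarrow> nat \<Rightarrow> real" where
  "greedy_sum a x 0 = 0"
| "greedy_sum a x (Suc n) =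
     (if greedy_sum a x n + a n \<le> x then greedy_sum a x n + a n else greedy_sum a x n)"

lemma tail_eq_sum_minus_initial:
  fixes a :: "nat \<Rightarrow> real"
  assumes "summable a"
  shows "(\<Sum>i. a (i + n)) = suminf a - sum a {..<n}"
  using suminf_minus_initial_segment[OF assms] by simp

text \<open>
  The upper bound is the invariant of the algorithm: the terms not yet examined always suffice to
  make up for the error.
\<close>

lemma greedy_sum_error:
  fixes a :: "nat \<Rightarrow> real"
  assumes summable: "summable a"
    and tail: "\<And>n. a n \<le> (\<Sum>i. a (i + Suc n))"
    and x: "0 \<le> x" "x \<le> suminf a"
  shows "greedy_sum a x n \<le> x \<and> x - greedy_sum a x n \<le> suminf a - sum a {..<n}"
proof (induction n)
  case 0
  then show ?case using x by simp
next
  case (Suc n)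
  have "a n \<le> suminf a - sum a {..<Suc n}"
    using tail[of n] tail_eq_sum_minus_initial[OF summable] by metis
  with Suc show ?case by auto
qed

lemma greedy_sum_tendsto:
  fixes a :: "nat \<Rightarrow> real"
  assumes summable: "summable a"
    and tail: "\<And>n. a n \<le> (\<Sum>i. a (i + Suc n))"
    and x: "0 \<le> x" "x \<le> suminf a"
  shows "greedy_sum a x \<longlonglongrightarrow> x"
proof (rule tendsto_sandwich)
  note error = greedy_sum_error[OF summable tail x]
  show "\<forall>\<^sub>F n in sequentially. x - (suminf a - sum a {..<n}) \<le> greedy_sum a x n"
  proof (intro always_eventually allI)
    show "x - (suminf a - sum a {..<n}) \<le> greedy_sum a x n" for n
      using error[of n] by linarith
  qed
  show "\<forall>\<^sub>F n in sequentially. greedy_sum a x n \<le> x"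
    using error by simp
  have "(\<lambda>n. x - (suminf a - sum a {..<n})) \<longlonglongrightarrow> x - (suminf a - suminf a)"
    by (intro tendsto_intros summable_LIMSEQ summable)
  then show "(\<lambda>n. x - (suminf a - sum a {..<n})) \<longlonglongrightarrow> x" by simp
qed simp

theorem Kakeya_subsums:
  fixes a :: "nat \<Rightarrow> real"
  assumes "summable a"
    and "\<And>n. a n \<le> (\<Sum>i. a (i + Suc n))"
    and "0 \<le> x" "x \<le> suminf a"
  shows "\<exists>d :: nat \<Rightarrow> nat. (\<forall>n. d n \<in> {0, 1}) \<and> (\<lambda>n. real (d n) * a n) sums x"
proof -
  define d :: "nat \<Rightarrow> nat" where "d n = (if greedy_sum a x n + a n \<le> x then 1 else 0)" for n
  have "(\<Sum>i<n. real (d i) * a i) = greedy_sum a x n" for n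
    by (induction n) (auto simp: d_def)
  then have "(\<lambda>n. real (d n) * a n) sums x"
    using greedy_sum_tendsto[OF assms] by (simp add: sums_def)
  moreover have "\<forall>n. d n \<in> {0, 1}" by (simp add: d_def)
  ultimately show ?thesis by blast
qed

text \<open>
  Telescoping the hypothesis in the form \<open>a i - a (i + 1) \<le> a (i + 1)\<close>.
\<close>

lemma term_le_tail_if_le_double_next:
  fixes a :: "nat \<Rightarrow> real"
  assumes "summable a" and double: "\<And>n. a n \<le> 2 * a (Suc n)"
  shows "a n \<le> (\<Sum>i. a (i + Suc n))"
proof -
  have "(\<lambda>i. a (i + n)) \<longlonglongrightarrow> 0"
    using summable_LIMSEQ_zero[OF assms(1)] by (rule LIMSEQ_ignore_initial_segment)
  from telescope_sums'[OF this] have diffs: "(\<lambda>i. a (i + n) - a (Suc i + n)) sums a n"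
    by simp
  have tail: "(\<lambda>i. a (i + Suc n)) sums (\<Sum>i. a (i + Suc n))"
    using assms(1) by (intro summable_sums summable_ignore_initial_segment)
  show ?thesis
  proof (rule sums_le[OF _ diffs tail])
    show "a (i + n) - a (Suc i + n) \<le> a (i + Suc n)" for i
      using double[of "i + n"] by simp
  qed
qed

lemma fib_Suc_Suc_le_double: "fib (Suc (Suc n)) \<le> 2 * fib (Suc n)"
  using fib_mono[of n "Suc n"] by simp

text \<open>
  From the second term on the series decays at least geometrically with ratio \<open>2/3\<close>: this is
  \<open>3 * fib (n + 1) \<le> 2 * fib (n + 2)\<close>, again a consequence of \<open>fib (n + 1) \<le> 2 * fib n\<close> for
  \<open>n \<ge> 1\<close>.
\<close>

lemma summable_fib_recip: "summable (\<lambda>i. 1 / real (fib (Suc i)))"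
proof (rule summable_ratio_test)
  show "norm (1 / real (fib (Suc (Suc n)))) \<le> 2 / 3 * norm (1 / real (fib (Suc n)))"
    if "n \<ge> 1" for n
  proof -
    from that obtain m where n: "n = Suc m" by (cases n) auto
    have "3 * fib (Suc n) \<le> 2 * fib (Suc (Suc n))"
      using fib_Suc_Suc_le_double[of m] by (simp add: n)
    then have "3 * real (fib (Suc n)) \<le> 2 * real (fib (Suc (Suc n)))"
      by linarith
    moreover have "0 < fib (Suc n)" "0 < fib (Suc (Suc n))"
      by (simp_all add: fib_neq_0_nat del: fib.simps)
    ultimately show ?thesis
      by (simp add: field_simps del: fib.simps)
  qed
qed simp

lemma fib_recip_le_tail:
  "1 / real (fib (Suc n)) \<le> (\<Sum>i. 1 / real (fib (Suc (i + Suc n))))"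
proof (rule term_le_tail_if_le_double_next[where a = "\<lambda>i. 1 / real (fib (Suc i))"])
  show "1 / real (fib (Suc n)) \<le> 2 * (1 / real (fib (Suc (Suc n))))" for n
  proof -
    have "real (fib (Suc (Suc n))) \<le> 2 * real (fib (Suc n))"
      using fib_Suc_Suc_le_double[of n] by linarith
    moreover have "0 < fib (Suc n)" "0 < fib (Suc (Suc n))"
      by (simp_all add: fib_neq_0_nat del: fib.simps)
    ultimately show ?thesis
      by (simp add: field_simps del: fib.simps)
  qed
qed (rule summable_fib_recip)

theorem theorem1p2:
  fixes x :: real
  shows "has_fib_expansion x \<longleftrightarrow> x \<in> {0..fib_recip_sum}"
proof
  assume "has_fib_expansion x"
  then obtain c :: "nat \<Rightarrow> nat" where digits: "\<forall>i\<ge>1. c i \<in> {0, 1}"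
    and c: "(\<lambda>i. real (c (Suc i)) / real (fib (Suc i))) sums x"
    by (auto simp: has_fib_expansion_def)
  have "real (c (Suc i)) \<le> 1" for i
    using digits[rule_format, of "Suc i"] by auto
  then have "real (c (Suc i)) / real (fib (Suc i)) \<le> 1 / real (fib (Suc i))" for i
    by (rule divide_right_mono) simp
  then have "x \<le> fib_recip_sum"
    unfolding fib_recip_sum_def by (rule sums_le[OF _ c summable_sums[OF summable_fib_recip]])
  moreover have "0 \<le> x"
    by (rule sums_le[OF _ sums_zero c]) simp
  ultimately show "x \<in> {0..fib_recip_sum}" by simp
next
  assume "x \<in> {0..fib_recip_sum}"
  then obtain d :: "nat \<Rightarrow> nat" where digits: "\<forall>n. d n \<in> {0, 1}"
    and d: "(\<lambda>n. real (d n) * (1 / real (fib (Suc n)))) sums x"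
    using Kakeya_subsums[OF summable_fib_recip fib_recip_le_tail, of x]
    by (auto simp: fib_recip_sum_def)
  show "has_fib_expansion x"
    unfolding has_fib_expansion_def
    using digits d by (intro exI[of _ "\<lambda>i. d (i - 1)"]) simp
qed

end
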